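(* Let $X_1,\ldots,X_n$ be i.i.d. observations with density $f$ with respect to $\mu$. Assume that the functions $f_1,\ldots,f_M\in L^2(\mu)$ satisfy $\|f_j\|_\infty\le L_0$ for all $j=1,\ldots,M$, and assume that the unknown density $f$ satisfies $\|f\|_\infty\le L$. Let $$\hat\theta\in\operatorname*{argmin}_{\theta\in\Lambda^M}\left(\|f_\theta\|^2-\frac2n\sum_{i=1}^nf_\theta(X_i)\right)+\frac12\sum_{j=1}^M\theta_j\|f_\theta-f_j\|^2 .$$ Then for any $x>0$, with probability greater than $1-\exp(-x)$, $$R(f_{\hat\theta})\le\min_{j=1,\ldots,M}R(f_j)+\left(4L+\frac{8L_0}{3}\right)\frac{\log(M)+x}{n}.$$
   Context: $(\mathcal{X},\mu)$ is a measure space, $f$ is an unknown probability density with respect to $\mu$, and $f_1,\ldots,f_M$ are deterministic functions. $\|\cdot\|$ denotes the $L^2(\mu)$ norm. $\Lambda^M=\{\theta\in\mathbf{R}^M:\ \theta_j\ge0\ \forall j,\ \sum_{j=1}^M\theta_j=1\}$, and $f_\theta=\sum_{j=1}^M\theta_jf_j$ for $\theta\in\Lambda^M$. The argmin is of the whole displayed expression (both terms). The risk of $g\in L^2(\mu)$ is $R(g)=\|g\|^2-2\int gf\,d\mu$; for the data-dependent function $f_{\hat\theta}$, $R(f_{\hat\theta})$ is the value of $R$ at the realized function. *)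

theory Defs
  imports "HOL-Probability.Probability"
begin

definition L2_functions :: "'a measure \<Rightarrow> ('a \<Rightarrow> real) set" where
  "L2_functions \<mu> = {g \<in> borel_measurable \<mu>. integrable \<mu> (\<lambda>x. (g x)\<^sup>2)}"

(* Bochner integral: this is the L2 norm only on L2_functions \<mu>; elsewhere it may be a junk value. *)
definition norm_L2 :: "'a measure \<Rightarrow> ('a \<Rightarrow> real) \<Rightarrow> real" where
  "norm_L2 \<mu> g = sqrt (\<integral>x. (g x)\<^sup>2 \<partial>\<mu>)"

definition norm_Linf :: "'a measure \<Rightarrow> ('a \<Rightarrow> real) \<Rightarrow> ereal" where
  "norm_Linf \<mu> g = esssup \<mu> (\<lambda>x. ereal \<bar>g x\<bar>)"

definition prob_density :: "'a measure \<Rightarrow> ('a \<Rightarrow> real) \<Rightarrow> bool" where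
  "prob_density \<mu> f \<longleftrightarrow>
     f \<in> borel_measurable \<mu> \<and> (AE x in \<mu>. 0 \<le> f x) \<and> (\<integral>\<^sup>+x. ennreal (f x) \<partial>\<mu>) = 1"

definition risk :: "'a measure \<Rightarrow> ('a \<Rightarrow> real) \<Rightarrow> ('a \<Rightarrow> real) \<Rightarrow> real" where
  "risk \<mu> f g = (norm_L2 \<mu> g)\<^sup>2 - 2 * (\<integral>x. g x * f x \<partial>\<mu>)"

(* The index set {1,...,M} is a finite type 'm, so that M = CARD('m) is an arbitrary positive number. *)
definition prob_simplex :: "(real ^ 'm) set" where
  "prob_simplex = {\<theta>. (\<forall>j. 0 \<le> \<theta> $ j) \<and> (\<Sum>j\<in>UNIV. \<theta> $ j) = 1}"

definition mixture :: "('m \<Rightarrow> 'a \<Rightarrow> real) \<Rightarrow> real ^ 'm \<Rightarrow> 'a \<Rightarrow> real" where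
  "mixture F \<theta> = (\<lambda>x. \<Sum>j\<in>UNIV. \<theta> $ j * F j x)"

(* Here xs 1, ..., xs n are the observed values. *)
definition Q_objective ::
  "'a measure \<Rightarrow> ('m \<Rightarrow> 'a \<Rightarrow> real) \<Rightarrow> nat \<Rightarrow> (nat \<Rightarrow> 'a) \<Rightarrow> real ^ 'm \<Rightarrow> real" where
  "Q_objective \<mu> F n xs \<theta> =
     ((norm_L2 \<mu> (mixture F \<theta>))\<^sup>2 - 2 / real n * (\<Sum>i=1..n. mixture F \<theta> (xs i)))
     + 1 / 2 * (\<Sum>j\<in>UNIV. \<theta> $ j * (norm_L2 \<mu> (\<lambda>x. mixture F \<theta> x - F j x))\<^sup>2)"

end

theory Submission
  imports Defs
begin

text \<open>Everything depends on \<open>\<theta>\<close> through the Gram form of \<open>f\<^sub>1, \<dots>, f\<^sub>M\<close>, so the criterion is a convex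
  quadratic function on the simplex. Its first-order condition at the minimizer \<open>\<theta>\<close> in the direction of
  the vertex \<open>k\<close> reads
    \<open>R(f\<^sub>\<theta>) - R(f\<^sub>k) \<le> \<Sum>j. \<theta>\<^sub>j (2 (P\<^sub>n - P)(f\<^sub>j - f\<^sub>k) - 1/2 \<parallel>f\<^sub>j - f\<^sub>k\<parallel>\<^sup>2)\<close>,
  a convex combination of \<open>M\<close> terms. Each term is controlled by Bernstein's inequality, whose
  variance part is absorbed by the penalty because \<open>P (f\<^sub>j - f\<^sub>k)\<^sup>2 \<le> L \<parallel>f\<^sub>j - f\<^sub>k\<parallel>\<^sup>2\<close>; a union bound
  over \<open>j\<close> finishes the proof, with \<open>k\<close> an index minimizing \<open>R(f\<^sub>k)\<close>.\<close>

section \<open>Bernstein's inequality\<close>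

text \<open>From the quadratic term on, the Taylor series is dominated by a geometric one:
  \<open>(k + 2)!\<close> is at least \<open>2 * 3 ^ k\<close>, so the ratio is
  \<open>s / 3\<close>. This is the origin of the factor \<open>1 / 3\<close> in Bernstein's
  inequality.\<close>

lemma exp_le_quadratic:
  fixes s t :: real
  assumes "\<bar>t\<bar> \<le> s" "s < 3"
  shows "exp t \<le> 1 + t + t\<^sup>2 / (2 * (1 - s / 3))"
proof -
  have s0: "0 \<le> s" using assms by linarith
  have fact_ge: "2 * 3 ^ k \<le> (fact (k + 2) :: real)" for k :: nat
  proof (induction k)
    case (Suc k)
    have "2 * 3 ^ Suc k \<le> 3 * (fact (k + 2) :: real)"
      using Suc unfolding power_Suc by linarith
    also have "\<dots> \<le> real (k + 3) * fact (k + 2)" by (intro mult_right_mono) auto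
    also have "\<dots> = fact (Suc k + 2)" by (simp add: mult_ac add_ac)
    finally show ?case .
  qed simp
  have term_le: "inverse (fact (k + 2)) *\<^sub>R t ^ (k + 2) \<le> t\<^sup>2 / 2 * (s / 3) ^ k" for k
  proof -
    have "t ^ (k + 2) \<le> \<bar>t ^ (k + 2)\<bar>" by simp
    also have "\<dots> = \<bar>t\<bar> ^ k * t\<^sup>2" by (simp add: power_abs power_add abs_mult power2_eq_square)
    finally have "inverse (fact (k + 2)) *\<^sub>R t ^ (k + 2)
        \<le> inverse (fact (k + 2)) * (\<bar>t\<bar> ^ k * t\<^sup>2)"
      unfolding real_scaleR_def by (rule mult_left_mono) simp
    also have "\<dots> \<le> inverse (2 * 3 ^ k) * (s ^ k * t\<^sup>2)"
    proof (rule mult_mono)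
      show "inverse (fact (k + 2)) \<le> inverse (2 * 3 ^ k :: real)"
        by (rule le_imp_inverse_le[OF fact_ge]) simp
      show "\<bar>t\<bar> ^ k * t\<^sup>2 \<le> s ^ k * t\<^sup>2"
        using assms by (intro mult_right_mono power_mono) auto
    qed (intro mult_nonneg_nonneg zero_le_power abs_ge_zero zero_le_power2 | simp)+
    also have "\<dots> = t\<^sup>2 / 2 * (s / 3) ^ k" by (simp add: field_simps power_divide)
    finally show ?thesis .
  qed
  have geo: "(\<lambda>k. (s / 3) ^ k) sums (1 / (1 - s / 3))"
    using s0 assms by (intro geometric_sums) auto
  have "exp t = 1 + t + (\<Sum>k. inverse (fact (k + 2)) *\<^sub>R t ^ (k + 2))"
    by (rule exp_first_two_terms)
  also have "(\<Sum>k. inverse (fact (k + 2)) *\<^sub>R t ^ (k + 2)) \<le> (\<Sum>k. t\<^sup>2 / 2 * (s / 3) ^ k)"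
    using term_le sums_summable[OF geo]
      summable_ignore_initial_segment[OF summable_exp_generic[of t], of 2]
    by (intro suminf_le summable_mult)
  also have "\<dots> = t\<^sup>2 / 2 * (1 / (1 - s / 3))"
    using geo by (subst suminf_mult) (auto simp: sums_iff)
  finally show ?thesis by simp
qed

text \<open>Integrating the quadratic bound on the exponential kills the linear term because
  \<open>Z\<close> is centred; \<open>1 + y \<le> exp y\<close> then restores an
  exponential.\<close>

lemma (in prob_space) expectation_exp_le_bernstein:
  fixes Z :: "'a \<Rightarrow> real"
  assumes [measurable]: "random_variable borel Z"
    and bound: "AE \<omega> in M. \<bar>Z \<omega>\<bar> \<le> b"
    and mean: "expectation Z = 0"
    and var: "expectation (\<lambda>\<omega>. (Z \<omega>)\<^sup>2) \<le> v"
    and l: "0 \<le> l" "l * b < 3"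
  shows "expectation (\<lambda>\<omega>. exp (l * Z \<omega>)) \<le> exp (l\<^sup>2 * v / (2 * (1 - l * b / 3)))"
proof -
  define c where "c = 1 / (2 * (1 - l * b / 3))"
  have c: "0 < c" using l by (simp add: c_def mult.commute)
  have int_Z: "integrable M Z"
    using bound by (intro integrable_const_bound[where B = b]) auto
  have int_Z2: "integrable M (\<lambda>\<omega>. (Z \<omega>)\<^sup>2)"
  proof (rule integrable_const_bound[where B = "b\<^sup>2"])
    show "AE \<omega> in M. norm ((Z \<omega>)\<^sup>2) \<le> b\<^sup>2"
      using bound by eventually_elim (simp flip: abs_le_square_iff)
  qed simp
  have bound_exp: "AE \<omega> in M. exp (l * Z \<omega>) \<le> 1 + l * Z \<omega> + l\<^sup>2 * c * (Z \<omega>)\<^sup>2"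
    using bound
  proof eventually_elim
    case (elim \<omega>)
    have "\<bar>l * Z \<omega>\<bar> \<le> l * b" using elim l by (simp add: abs_mult mult_left_mono)
    from exp_le_quadratic[OF this l(2)] show ?case
      by (simp add: c_def power_mult_distrib mult_ac)
  qed
  have "expectation (\<lambda>\<omega>. exp (l * Z \<omega>)) \<le> expectation (\<lambda>\<omega>. 1 + l * Z \<omega> + l\<^sup>2 * c * (Z \<omega>)\<^sup>2)"
    using int_Z int_Z2 bound_exp
    by (intro integral_mono_AE') (auto elim!: eventually_mono intro: order_trans[OF exp_ge_zero])
  also have "\<dots> = 1 + l\<^sup>2 * c * expectation (\<lambda>\<omega>. (Z \<omega>)\<^sup>2)"
    using int_Z int_Z2 mean by (simp add: prob_space)
  also have "\<dots> \<le> 1 + l\<^sup>2 * c * v"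
    using var c by (intro add_left_mono mult_left_mono) auto
  also have "\<dots> \<le> exp (l\<^sup>2 * c * v)" by (rule exp_ge_add_one_self)
  finally show ?thesis by (simp add: c_def)
qed

text \<open>Chernoff's bound, with independence factorizing the moment generating function. The
  parameter \<open>l\<close> stays free: it will be chosen to cancel the variance against the
  penalty, not to optimize the tail.\<close>

lemma (in prob_space) bernstein_ineq_ge:
  fixes Z :: "'i \<Rightarrow> 'a \<Rightarrow> real"
  assumes I: "finite I"
    and indep: "indep_vars (\<lambda>_. borel) Z I"
    and bound: "\<And>i. i \<in> I \<Longrightarrow> AE \<omega> in M. \<bar>Z i \<omega>\<bar> \<le> b"
    and mean: "\<And>i. i \<in> I \<Longrightarrow> expectation (Z i) = 0"
    and var: "\<And>i. i \<in> I \<Longrightarrow> expectation (\<lambda>\<omega>. (Z i \<omega>)\<^sup>2) \<le> v"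
    and l: "0 < l" "l * b < 3"
  shows "prob {\<omega> \<in> space M. t \<le> (\<Sum>i\<in>I. Z i \<omega>)}
    \<le> exp (real (card I) * (l\<^sup>2 * v / (2 * (1 - l * b / 3))) - l * t)"
proof -
  have Z[measurable]: "random_variable borel (Z i)" if "i \<in> I" for i
    using indep that by (auto simp: indep_vars_def)
  have int: "integrable M (\<lambda>\<omega>. exp (l * Z i \<omega>))" if "i \<in> I" for i
    using bound[OF that] Z[OF that] l
    by (intro integrable_const_bound[where B = "exp (l * b)"])
      (auto elim!: eventually_mono simp: abs_le_iff)
  have indep_exp: "indep_vars (\<lambda>_. borel) (\<lambda>i \<omega>. exp (l * Z i \<omega>)) I"
    using indep by (rule indep_vars_compose2) simp
  have "prob {\<omega> \<in> space M. t \<le> (\<Sum>i\<in>I. Z i \<omega>)}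
      \<le> exp (- l * t) * expectation (\<lambda>\<omega>. exp (l * (\<Sum>i\<in>I. Z i \<omega>)))"
  proof -
    have "integrable M (\<lambda>\<omega>. exp (l * (\<Sum>i\<in>I. Z i \<omega>)))"
      using indep_vars_integrable[OF I indep_exp int] I by (simp add: sum_distrib_left exp_sum)
    then show ?thesis
      using Chernoff_ineq_ge[of l "space M" "\<lambda>\<omega>. \<Sum>i\<in>I. Z i \<omega>" t] l
      by (simp add: set_integrable_def set_lebesgue_integral_def indicator_def
          cong: Bochner_Integration.integrable_cong Bochner_Integration.integral_cong)
  qed
  also have "expectation (\<lambda>\<omega>. exp (l * (\<Sum>i\<in>I. Z i \<omega>))) = (\<Prod>i\<in>I. expectation (\<lambda>\<omega>. exp (l * Z i \<omega>)))"
    using indep_vars_lebesgue_integral[OF I indep_exp int] I by (simp add: sum_distrib_left exp_sum)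
  also have "\<dots> \<le> (\<Prod>i\<in>I. exp (l\<^sup>2 * v / (2 * (1 - l * b / 3))))"
    using bound mean var l Z
    by (intro prod_mono conjI expectation_exp_le_bernstein integral_nonneg_AE) auto
  also have "exp (- l * t) * \<dots> = exp (real (card I) * (l\<^sup>2 * v / (2 * (1 - l * b / 3))) - l * t)"
    by (simp only: prod_constant exp_of_nat_mult[symmetric] exp_add[symmetric]) simp
  finally show ?thesis by simp
qed

section \<open>The penalized quadratic form on the simplex\<close>

text \<open>If the directional derivative towards \<open>\<eta>\<close> were negative, a short step
  along the segment, which stays in the convex set, would lower the objective.\<close>

lemma quadratic_min_first_order:
  fixes B :: "'b::real_inner \<Rightarrow> 'b \<Rightarrow> real"
  assumes B: "bilinear B" and sym: "\<And>v w. B v w = B w v"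
    and "convex S" "\<theta> \<in> S" "\<eta> \<in> S"
    and min: "\<And>\<zeta>. \<zeta> \<in> S \<Longrightarrow> B \<theta> \<theta> / 2 + q \<bullet> \<theta> \<le> B \<zeta> \<zeta> / 2 + q \<bullet> \<zeta>"
  shows "0 \<le> B \<theta> (\<eta> - \<theta>) + q \<bullet> (\<eta> - \<theta>)"
proof (rule ccontr)
  define d where "d = \<eta> - \<theta>"
  define D where "D = B \<theta> d + q \<bullet> d"
  assume "\<not> ?thesis"
  then have D: "D < 0" by (simp add: D_def d_def)
  \<comment> \<open>The step is short enough that \<open>t * B d d \<le> - D\<close>, so the
    quadratic term cancels at most half of the decrease \<open>D\<close>; the \<open>+ 1\<close>
    keeps the denominator positive.\<close>
  define t where "t = min 1 (- D / (\<bar>B d d\<bar> + 1))"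
  have t: "0 < t" "t \<le> 1" using D by (auto simp: t_def divide_neg_pos)
  have "t \<le> - D / (\<bar>B d d\<bar> + 1)" by (simp add: t_def)
  then have "t * (\<bar>B d d\<bar> + 1) \<le> - D" by (intro pos_le_divide_eq[THEN iffD1]) auto
  moreover have "t * B d d \<le> t * (\<bar>B d d\<bar> + 1)" using t by (intro mult_left_mono) auto
  ultimately have small: "t * B d d \<le> - D" by linarith
  have "(1 - t) *\<^sub>R \<theta> + t *\<^sub>R \<eta> \<in> S"
    using \<open>convex S\<close> \<open>\<theta> \<in> S\<close> \<open>\<eta> \<in> S\<close> t by (intro convexD) auto
  also have "(1 - t) *\<^sub>R \<theta> + t *\<^sub>R \<eta> = \<theta> + t *\<^sub>R d" by (simp add: d_def algebra_simps)
  finally have "B \<theta> \<theta> / 2 + q \<bullet> \<theta> \<le> B (\<theta> + t *\<^sub>R d) (\<theta> + t *\<^sub>R d) / 2 + q \<bullet> (\<theta> + t *\<^sub>R d)"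
    by (rule min)
  then have "0 \<le> t * (D + t * B d d / 2)"
    using sym[of d \<theta>] by (simp add: bilinear_ladd[OF B] bilinear_radd[OF B] bilinear_lmul[OF B]
        bilinear_rmul[OF B] inner_add_right D_def field_simps)
  then have "0 \<le> D + t * B d d / 2" using t by (simp add: zero_le_mult_iff)
  then show False using small D by linarith
qed

text \<open>Adding the first-order conditions of the two minimizers, each towards the other, cancels
  \<open>q\<close> and leaves \<open>B (\<theta> - \<eta>) (\<theta> - \<eta>) \<le> 0\<close>. As
  \<open>B\<close> may be degenerate, the minimizers themselves can differ.\<close>

lemma quadratic_min_unique:
  fixes B :: "'b::real_inner \<Rightarrow> 'b \<Rightarrow> real"
  assumes B: "bilinear B" and sym: "\<And>v w. B v w = B w v" and psd: "\<And>v. 0 \<le> B v v"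
    and S: "convex S" "\<theta> \<in> S" "\<eta> \<in> S"
    and "\<And>\<zeta>. \<zeta> \<in> S \<Longrightarrow> B \<theta> \<theta> / 2 + q \<bullet> \<theta> \<le> B \<zeta> \<zeta> / 2 + q \<bullet> \<zeta>"
    and "\<And>\<zeta>. \<zeta> \<in> S \<Longrightarrow> B \<eta> \<eta> / 2 + q \<bullet> \<eta> \<le> B \<zeta> \<zeta> / 2 + q \<bullet> \<zeta>"
  shows "B (\<theta> - \<eta>) (\<theta> - \<eta>) = 0"
proof -
  have "0 \<le> B \<theta> (\<eta> - \<theta>) + q \<bullet> (\<eta> - \<theta>)" "0 \<le> B \<eta> (\<theta> - \<eta>) + q \<bullet> (\<theta> - \<eta>)"
    using quadratic_min_first_order[OF B sym] assms by blast+
  then have "B (\<theta> - \<eta>) (\<theta> - \<eta>) \<le> 0"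
    by (simp add: bilinear_lsub[OF B] bilinear_rsub[OF B] inner_diff_right)
  with psd show ?thesis by (simp add: antisym)
qed

section \<open>Geometry of the probability simplex and its vertices\<close>

lemma axis_mem_prob_simplex: "axis k 1 \<in> prob_simplex"
  by (simp add: prob_simplex_def axis_def)

lemma convex_prob_simplex: "convex prob_simplex"
  unfolding convex_def prob_simplex_def
  by (auto simp: sum.distrib sum_distrib_left[symmetric])

lemma compact_prob_simplex: "compact (prob_simplex :: (real ^ 'm) set)"
proof -
  have "norm \<theta> \<le> 1" if "\<theta> \<in> prob_simplex" for \<theta> :: "real ^ 'm"
    using that norm_le_l1_cart[of \<theta>] by (simp add: prob_simplex_def)
  then have "bounded (prob_simplex :: (real ^ 'm) set)" by (auto simp: bounded_iff)
  moreover have simplex_eq: "prob_simplex = (\<Inter>j. {\<theta> :: real ^ 'm. 0 \<le> \<theta> $ j}) \<inter> {\<theta>. (\<Sum>j\<in>UNIV. \<theta> $ j) = 1}"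
    by (auto simp: prob_simplex_def)
  have "closed (prob_simplex :: (real ^ 'm) set)"
    unfolding simplex_eq
    by (intro closed_Int closed_INT closed_Collect_le closed_Collect_eq continuous_intros ballI)
  ultimately show ?thesis by (simp add: compact_eq_bounded_closed)
qed

lemma linear_eq_sum_axis:
  fixes h :: "real ^ 'm \<Rightarrow> real"
  assumes "linear h"
  shows "(\<Sum>j\<in>UNIV. v $ j * h (axis j 1)) = h v"
proof -
  have "h v = h (\<Sum>j\<in>UNIV. (v $ j) *\<^sub>R axis j 1)"
    using basis_expansion[of v] by (simp add: scalar_mult_eq_scaleR)
  also have "\<dots> = (\<Sum>j\<in>UNIV. v $ j * h (axis j 1))"
    using assms by (simp add: linear_sum linear_scale)
  finally show ?thesis by simp
qed

text \<open>Expand each square and use that the weights sum to one. The point \<open>w\<close> is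
  independent of \<open>\<theta>\<close>: \<open>w = \<theta>\<close> rewrites the penalty, and
  \<open>w = axis k 1\<close> evaluates the quadratic terms of the oracle bound.\<close>

lemma sum_simplex_bilinear_diff:
  fixes B :: "real ^ 'm \<Rightarrow> real ^ 'm \<Rightarrow> real"
  assumes B: "bilinear B" and sym: "\<And>v w. B v w = B w v" and "\<theta> \<in> prob_simplex"
  shows "(\<Sum>j\<in>UNIV. \<theta> $ j * B (w - axis j 1) (w - axis j 1))
    = B w w - 2 * B w \<theta> + (\<Sum>j\<in>UNIV. \<theta> $ j * B (axis j 1) (axis j 1))"
proof -
  have "(\<Sum>j\<in>UNIV. \<theta> $ j * B (w - axis j 1) (w - axis j 1))
    = (\<Sum>j\<in>UNIV. \<theta> $ j * B w w - 2 * (\<theta> $ j * B w (axis j 1)) + \<theta> $ j * B (axis j 1) (axis j 1))"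
  proof (intro sum.cong refl)
    fix j
    show "\<theta> $ j * B (w - axis j 1) (w - axis j 1)
      = \<theta> $ j * B w w - 2 * (\<theta> $ j * B w (axis j 1)) + \<theta> $ j * B (axis j 1) (axis j 1)"
      using sym[of "axis j 1" w] by (simp add: bilinear_lsub[OF B] bilinear_rsub[OF B] algebra_simps)
  qed
  also have "\<dots> = (\<Sum>j\<in>UNIV. \<theta> $ j) * B w w - 2 * (\<Sum>j\<in>UNIV. \<theta> $ j * B w (axis j 1))
      + (\<Sum>j\<in>UNIV. \<theta> $ j * B (axis j 1) (axis j 1))"
    by (simp add: sum.distrib sum_subtractf sum_distrib_left sum_distrib_right)
  also have "(\<Sum>j\<in>UNIV. \<theta> $ j * B w (axis j 1)) = B w \<theta>"
    using B by (intro linear_eq_sum_axis) (simp add: bilinear_def)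
  finally show ?thesis using \<open>\<theta> \<in> prob_simplex\<close> by (simp add: prob_simplex_def)
qed

text \<open>The criterion with the data abstracted away: \<open>B\<close> plays the Gram form of the
  dictionary and \<open>c\<close> the vector of empirical means.\<close>

definition penalized_form :: "(real ^ 'm \<Rightarrow> real ^ 'm \<Rightarrow> real) \<Rightarrow> real ^ 'm \<Rightarrow> real ^ 'm \<Rightarrow> real" where
  "penalized_form B c \<theta> =
     B \<theta> \<theta> - 2 * (c \<bullet> \<theta>) + 1 / 2 * (\<Sum>j\<in>UNIV. \<theta> $ j * B (\<theta> - axis j 1) (\<theta> - axis j 1))"

text \<open>On the simplex the penalty is a linear function minus
  \<open>B \<theta> \<theta> / 2\<close>, so half of the quadratic term survives and the criterion
  is convex whenever \<open>B\<close> is positive semidefinite.\<close>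

lemma penalized_form_eq:
  assumes "bilinear B" "\<And>v w. B v w = B w v" "\<theta> \<in> prob_simplex"
  shows "penalized_form B c \<theta>
    = B \<theta> \<theta> / 2 + ((\<chi> j. B (axis j 1) (axis j 1) / 2) - 2 *\<^sub>R c) \<bullet> \<theta>"
proof -
  have "(\<chi> j. B (axis j 1) (axis j 1) / 2) \<bullet> \<theta> = (\<Sum>j\<in>UNIV. \<theta> $ j * B (axis j 1) (axis j 1)) / 2"
    by (simp add: inner_vec_def sum_divide_distrib mult.commute)
  then show ?thesis
    by (simp add: penalized_form_def sum_simplex_bilinear_diff[OF assms] inner_diff_left
        add_divide_distrib diff_divide_distrib)
qed

lemma penalized_form_min_unique:
  fixes B :: "real ^ 'm \<Rightarrow> real ^ 'm \<Rightarrow> real"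
  assumes B: "bilinear B" "\<And>v w. B v w = B w v" and "\<And>v. 0 \<le> B v v"
    and \<theta>: "is_arg_min (penalized_form B c) (\<lambda>\<theta>. \<theta> \<in> prob_simplex) \<theta>"
    and \<eta>: "is_arg_min (penalized_form B c) (\<lambda>\<theta>. \<theta> \<in> prob_simplex) \<eta>"
  shows "B (\<theta> - \<eta>) (\<theta> - \<eta>) = 0"
proof (rule quadratic_min_unique[OF assms(1-3) convex_prob_simplex])
  show simplex: "\<theta> \<in> prob_simplex" "\<eta> \<in> prob_simplex"
    using \<theta> \<eta> by (simp_all add: is_arg_min_linorder)
  let ?q = "(\<chi> j. B (axis j 1) (axis j 1) / 2) - 2 *\<^sub>R c"
  fix \<zeta> :: "real ^ 'm" assume \<zeta>: "\<zeta> \<in> prob_simplex"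
  have "penalized_form B c \<theta> \<le> penalized_form B c \<zeta>" "penalized_form B c \<eta> \<le> penalized_form B c \<zeta>"
    using \<theta> \<eta> \<zeta> by (simp_all add: is_arg_min_linorder)
  then show "B \<theta> \<theta> / 2 + ?q \<bullet> \<theta> \<le> B \<zeta> \<zeta> / 2 + ?q \<bullet> \<zeta>" "B \<eta> \<eta> / 2 + ?q \<bullet> \<eta> \<le> B \<zeta> \<zeta> / 2 + ?q \<bullet> \<zeta>"
    unfolding penalized_form_eq[OF B simplex(1)] penalized_form_eq[OF B simplex(2)] penalized_form_eq[OF B \<zeta>]
    by this
qed

text \<open>This is the first-order condition towards the vertex \<open>k\<close>, rearranged. With
  \<open>c\<close> the empirical and \<open>p\<close> the true means, \<open>c - p\<close> carries
  all the randomness.\<close>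

lemma penalized_form_min_oracle:
  assumes B: "bilinear B" and sym: "\<And>v w. B v w = B w v"
    and min: "is_arg_min (penalized_form B c) (\<lambda>\<theta>. \<theta> \<in> prob_simplex) \<theta>"
  shows "B \<theta> \<theta> - 2 * (p \<bullet> \<theta>) \<le> B (axis k 1) (axis k 1) - 2 * (p \<bullet> axis k 1)
    + (\<Sum>j\<in>UNIV. \<theta> $ j * (2 * ((c - p) \<bullet> (axis j 1 - axis k 1))
        - 1 / 2 * B (axis j 1 - axis k 1) (axis j 1 - axis k 1)))"
proof -
  let ?e = "\<lambda>j. axis j 1 :: real ^ 'a"
  define \<beta> where "\<beta> = (\<chi> j. B (?e j) (?e j) / 2)"
  have \<theta>: "\<theta> \<in> prob_simplex" using min by (simp add: is_arg_min_linorder)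
  have \<beta>\<theta>: "\<beta> \<bullet> \<theta> = (\<Sum>j\<in>UNIV. \<theta> $ j * B (?e j) (?e j)) / 2"
    by (simp add: \<beta>_def inner_vec_def sum_divide_distrib mult.commute)
  have \<beta>k: "\<beta> \<bullet> ?e k = B (?e k) (?e k) / 2" by (simp add: \<beta>_def inner_axis)
  have "0 \<le> B \<theta> (?e k - \<theta>) + (\<beta> - 2 *\<^sub>R c) \<bullet> (?e k - \<theta>)"
    using min by (intro quadratic_min_first_order[OF B sym convex_prob_simplex \<theta> axis_mem_prob_simplex])
      (auto simp: is_arg_min_linorder penalized_form_eq[OF B sym] \<beta>_def)
  then have first_order: "0 \<le> B \<theta> (?e k) - B \<theta> \<theta> + \<beta> \<bullet> ?e k - \<beta> \<bullet> \<theta> - 2 * (c \<bullet> ?e k) + 2 * (c \<bullet> \<theta>)"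
    by (simp add: bilinear_rsub[OF B] inner_diff_left inner_diff_right)
  have lin: "(\<Sum>j\<in>UNIV. \<theta> $ j * ((c - p) \<bullet> (?e j - ?e k))) = (c - p) \<bullet> \<theta> - (c - p) \<bullet> ?e k"
  proof -
    have "(\<Sum>j\<in>UNIV. \<theta> $ j * ((c - p) \<bullet> (?e j - ?e k)))
      = (\<Sum>j\<in>UNIV. \<theta> $ j * ((c - p) \<bullet> ?e j)) - (\<Sum>j\<in>UNIV. \<theta> $ j) * ((c - p) \<bullet> ?e k)"
      by (simp add: inner_diff_right right_diff_distrib sum_subtractf sum_distrib_right)
    also have "(\<Sum>j\<in>UNIV. \<theta> $ j * ((c - p) \<bullet> ?e j)) = (c - p) \<bullet> \<theta>"
      by (intro linear_eq_sum_axis bounded_linear.linear bounded_linear_inner_right)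
    finally show ?thesis using \<theta> by (simp add: prob_simplex_def)
  qed
  \<comment> \<open>Reversing the differences puts the sum in the form of
    \<open>sum_simplex_bilinear_diff\<close> with \<open>w = axis k 1\<close>.\<close>
  have flip: "B (?e j - ?e k) (?e j - ?e k) = B (?e k - ?e j) (?e k - ?e j)" for j
    by (simp add: bilinear_lsub[OF B] bilinear_rsub[OF B])
  let ?s = "\<Sum>j\<in>UNIV. \<theta> $ j * (2 * ((c - p) \<bullet> (?e j - ?e k)) - 1 / 2 * B (?e j - ?e k) (?e j - ?e k))"
  have "?s = 2 * (\<Sum>j\<in>UNIV. \<theta> $ j * ((c - p) \<bullet> (?e j - ?e k)))
      - 1 / 2 * (\<Sum>j\<in>UNIV. \<theta> $ j * B (?e k - ?e j) (?e k - ?e j))"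
    unfolding flip sum_distrib_left sum_subtractf[symmetric]
    by (intro sum.cong refl) (simp add: algebra_simps)
  also have "\<dots> = 2 * ((c - p) \<bullet> \<theta> - (c - p) \<bullet> ?e k)
      - 1 / 2 * (B (?e k) (?e k) - 2 * B \<theta> (?e k) + 2 * (\<beta> \<bullet> \<theta>))"
    unfolding lin sum_simplex_bilinear_diff[OF B sym \<theta>] \<beta>\<theta> sym[of "?e k" \<theta>] by simp
  finally have sum_eq: "?s = \<dots>" .
  \<comment> \<open>In scalar form the goal is exactly the first-order condition; \<open>q\<close>
    stands for \<open>\<beta> \<bullet> \<theta>\<close>.\<close>
  have arith: "b\<theta> - 2 * p\<theta> \<le> bk - 2 * pk + (2 * (c\<theta> - p\<theta> - (ck - pk)) - 1 / 2 * (bk - 2 * b\<theta>k + 2 * q))"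
    if "0 \<le> b\<theta>k - b\<theta> + bk / 2 - q - 2 * ck + 2 * c\<theta>"
    for b\<theta> p\<theta> bk pk c\<theta> ck b\<theta>k q :: real
    using that by (simp add: algebra_simps)
  show ?thesis
    unfolding sum_eq unfolding inner_diff_left by (rule arith[OF first_order[unfolded \<beta>k]])
qed

text \<open>The set is the projection, along the compact \<open>S\<close>, of a closed set of pairs:
  minimality is an intersection of closed conditions, one for each competitor \<open>\<eta>\<close>.
  It gives measurability without selecting a minimizer.\<close>

lemma closed_argmin_sublevel:
  fixes S :: "'b::euclidean_space set" and H :: "'c::euclidean_space \<Rightarrow> 'b \<Rightarrow> real"
  assumes "compact S"
    and H: "continuous_on UNIV (\<lambda>(\<theta>, c). H c \<theta>)" and r: "continuous_on UNIV r"
  shows "closed {c. \<exists>\<theta>. is_arg_min (H c) (\<lambda>\<theta>. \<theta> \<in> S) \<theta> \<and> r \<theta> \<le> (K :: real)}"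
proof -
  define T where "T = {z. r (fst z) \<le> K} \<inter> (\<Inter>\<eta>\<in>S. {z. H (snd z) (fst z) \<le> H (snd z) \<eta>})"
  have H': "continuous_on UNIV (\<lambda>z. H (g z) (h z))"
    if "continuous_on UNIV g" "continuous_on UNIV h" for g :: "'b \<times> 'c \<Rightarrow> 'c" and h
    using continuous_on_compose2[OF H, of UNIV "\<lambda>z. (h z, g z)"] that
    by (auto intro!: continuous_intros)
  have r': "continuous_on UNIV (\<lambda>z :: 'b \<times> 'c. r (fst z))"
    by (rule continuous_on_compose2[OF r]) (auto intro: continuous_intros)
  have "closed T"
    unfolding T_def
    by (intro closed_Int closed_INT ballI closed_Collect_le H' r' continuous_intros)
  from closed_compact_projection[OF \<open>compact S\<close> this] show ?thesis
    by (rule back_subst[of closed]) (auto simp: T_def is_arg_min_linorder)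
qed

section \<open>Mixtures and their risk\<close>

lemma L2_functions_add:
  assumes "u \<in> L2_functions \<mu>" "v \<in> L2_functions \<mu>"
  shows "(\<lambda>x. u x + v x) \<in> L2_functions \<mu>"
proof -
  have [measurable]: "u \<in> borel_measurable \<mu>" "v \<in> borel_measurable \<mu>"
    and int: "integrable \<mu> (\<lambda>x. 2 * (u x)\<^sup>2 + 2 * (v x)\<^sup>2)"
    using assms by (auto simp: L2_functions_def)
  have "integrable \<mu> (\<lambda>x. (u x + v x)\<^sup>2)"
  proof (rule Bochner_Integration.integrable_bound[OF int])
    have "(u x + v x)\<^sup>2 \<le> 2 * (u x)\<^sup>2 + 2 * (v x)\<^sup>2" for x
      using sum_squares_bound[of "u x" "v x"] by (simp add: power2_sum)
    then show "AE x in \<mu>. norm ((u x + v x)\<^sup>2) \<le> norm (2 * (u x)\<^sup>2 + 2 * (v x)\<^sup>2)"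
      by (intro AE_I2) simp
  qed simp
  then show ?thesis by (simp add: L2_functions_def)
qed

lemma L2_functions_scale:
  "u \<in> L2_functions \<mu> \<Longrightarrow> (\<lambda>x. c * u x) \<in> L2_functions \<mu>"
  by (auto simp: L2_functions_def power_mult_distrib)

lemma L2_functions_diff:
  assumes "u \<in> L2_functions \<mu>" "v \<in> L2_functions \<mu>"
  shows "(\<lambda>x. u x - v x) \<in> L2_functions \<mu>"
  using L2_functions_add[OF assms(1) L2_functions_scale[OF assms(2), of "-1"]] by simp

lemma L2_functions_sum:
  assumes "\<And>i. i \<in> I \<Longrightarrow> u i \<in> L2_functions \<mu>"
  shows "(\<lambda>x. \<Sum>i\<in>I. u i x) \<in> L2_functions \<mu>"
  using assms
proof (induction I rule: infinite_finite_induct)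
  case (insert i I)
  then show ?case using L2_functions_add[of "u i" \<mu> "\<lambda>x. \<Sum>i\<in>I. u i x"] by simp
qed (auto simp: L2_functions_def)

lemma L2_functions_integrable_mult:
  assumes "u \<in> L2_functions \<mu>" "v \<in> L2_functions \<mu>"
  shows "integrable \<mu> (\<lambda>x. u x * v x)"
proof -
  have [measurable]: "u \<in> borel_measurable \<mu>" "v \<in> borel_measurable \<mu>"
    and int: "integrable \<mu> (\<lambda>x. (u x)\<^sup>2 + (v x)\<^sup>2)"
    using assms by (auto simp: L2_functions_def)
  have "\<bar>u x * v x\<bar> \<le> (u x)\<^sup>2 + (v x)\<^sup>2" for x
  proof -
    have "2 * (\<bar>u x\<bar> * \<bar>v x\<bar>) \<le> (u x)\<^sup>2 + (v x)\<^sup>2"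
      using sum_squares_bound[of "\<bar>u x\<bar>" "\<bar>v x\<bar>"] by simp
    moreover have "0 \<le> \<bar>u x\<bar> * \<bar>v x\<bar>" by simp
    ultimately show ?thesis unfolding abs_mult by linarith
  qed
  then show ?thesis
    by (intro Bochner_Integration.integrable_bound[OF int]) (auto intro!: AE_I2)
qed

section \<open>Mixtures as linear images of weight vectors\<close>

lemma mixture_L2_functions: "(\<And>j. F j \<in> L2_functions \<mu>) \<Longrightarrow> mixture F v \<in> L2_functions \<mu>"
  unfolding mixture_def by (intro L2_functions_sum L2_functions_scale)

lemma mixture_add: "mixture F (v + w) x = mixture F v x + mixture F w x"
  by (simp add: mixture_def sum.distrib distrib_right)

lemma mixture_scale: "mixture F (c *\<^sub>R v) x = c * mixture F v x"
  by (simp add: mixture_def sum_distrib_left mult.assoc)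

lemma mixture_diff: "mixture F (v - w) x = mixture F v x - mixture F w x"
  by (simp add: mixture_def sum_subtractf left_diff_distrib)

lemma mixture_axis: "mixture F (axis j 1) = F j"
  by (simp add: mixture_def axis_def if_distrib[of "\<lambda>a. a * _"] cong: if_cong)

text \<open>The Gram form of the dictionary, taken on all of the weight space so that
  \<open>v - w\<close> represents a difference of mixtures. It is degenerate when the
  \<open>F j\<close> are linearly dependent almost everywhere.\<close>

definition mixture_form :: "'a measure \<Rightarrow> ('m \<Rightarrow> 'a \<Rightarrow> real) \<Rightarrow> real ^ 'm \<Rightarrow> real ^ 'm \<Rightarrow> real" where
  "mixture_form \<mu> F v w = (\<integral>x. mixture F v x * mixture F w x \<partial>\<mu>)"

lemma mixture_form_sym: "mixture_form \<mu> F v w = mixture_form \<mu> F w v"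
  by (simp add: mixture_form_def mult.commute)

lemma mixture_form_nonneg: "0 \<le> mixture_form \<mu> F v v"
  by (simp add: mixture_form_def)

lemma bilinear_mixture_form:
  assumes "\<And>j. F j \<in> L2_functions \<mu>"
  shows "bilinear (mixture_form \<mu> F)"
proof -
  have "linear (mixture_form \<mu> F v)" for v
    by (rule linearI)
      (auto simp: mixture_form_def mixture_add mixture_scale distrib_left mult.left_commute
        intro!: Bochner_Integration.integral_add L2_functions_integrable_mult mixture_L2_functions assms)
  then show ?thesis
    by (auto simp: bilinear_def mixture_form_sym[of \<mu> F _ v for v])
qed

lemma norm_L2_power2: "(norm_L2 \<mu> g)\<^sup>2 = (\<integral>x. (g x)\<^sup>2 \<partial>\<mu>)"
  by (simp add: norm_L2_def)

lemma norm_L2_mixture: "(norm_L2 \<mu> (mixture F v))\<^sup>2 = mixture_form \<mu> F v v"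
  by (simp only: norm_L2_power2 mixture_form_def) (simp add: power2_eq_square)

text \<open>The observations enter only through the empirical means of the \<open>F j\<close>, and
  \<open>f_\<theta> - f_j\<close> is the mixture with weights
  \<open>\<theta> - axis j 1\<close>.\<close>

lemma Q_objective_eq_penalized_form:
  "Q_objective \<mu> F n xs = penalized_form (mixture_form \<mu> F) (\<chi> j. (\<Sum>i=1..n. F j (xs i)) / real n)"
proof
  fix \<theta>
  have "(\<Sum>i=1..n. mixture F \<theta> (xs i)) = (\<Sum>j\<in>UNIV. \<theta> $ j * (\<Sum>i=1..n. F j (xs i)))"
    unfolding mixture_def sum_distrib_left by (rule sum.swap)
  then have "(\<Sum>i=1..n. mixture F \<theta> (xs i)) / real n
      = (\<chi> j. (\<Sum>i=1..n. F j (xs i)) / real n) \<bullet> \<theta>"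
    by (simp add: inner_vec_def sum_divide_distrib[of _ UNIV] mult.commute)
  moreover have "mixture F \<theta> x - F j x = mixture F (\<theta> - axis j 1) x" for j x
    by (simp add: mixture_diff mixture_axis)
  ultimately show "Q_objective \<mu> F n xs \<theta>
      = penalized_form (mixture_form \<mu> F) (\<chi> j. (\<Sum>i=1..n. F j (xs i)) / real n) \<theta>"
    by (simp add: Q_objective_def penalized_form_def norm_L2_mixture)
qed

section \<open>Essential bounds and integrals against the density\<close>

lemma norm_Linf_leD:
  assumes "norm_Linf \<mu> g \<le> ereal K"
  shows "AE x in \<mu>. \<bar>g x\<bar> \<le> K"
proof -
  have "AE x in \<mu>. ereal \<bar>g x\<bar> \<le> norm_Linf \<mu> g"
    unfolding norm_Linf_def by (rule esssup_AE)
  then show ?thesis using assms by (auto elim!: eventually_mono dest: order_trans)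
qed

lemma integrable_bounded_mult:
  fixes f g :: "'a \<Rightarrow> real"
  assumes f: "integrable \<mu> f" and [measurable]: "g \<in> borel_measurable \<mu>"
    and "AE x in \<mu>. \<bar>g x\<bar> \<le> K"
  shows "integrable \<mu> (\<lambda>x. g x * f x)"
proof (rule Bochner_Integration.integrable_bound)
  show "integrable \<mu> (\<lambda>x. K * f x)" using f by simp
  show "(\<lambda>x. g x * f x) \<in> borel_measurable \<mu>" using f by simp
  show "AE x in \<mu>. norm (g x * f x) \<le> norm (K * f x)"
    using assms(3)
  proof eventually_elim
    case (elim x)
    then have "\<bar>g x\<bar> \<le> \<bar>K\<bar>" by linarith
    then show ?case by (simp add: abs_mult mult_right_mono)
  qed
qed

lemma prob_density_integrable: "prob_density \<mu> f \<Longrightarrow> integrable \<mu> f"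
  by (rule integrableI_nonneg) (auto simp: prob_density_def)

lemma prob_density_integral:
  assumes "prob_density \<mu> f"
  shows "(\<integral>x. f x \<partial>\<mu>) = 1"
  using assms integral_eq_nn_integral[of f \<mu>] by (simp add: prob_density_def)

text \<open>Otherwise the density would vanish almost everywhere and could not integrate to one.
  Strictness keeps the later exponential parameter \<open>1 / (2 * L + 2 * a / 3)\<close> well
  defined even for \<open>a = 0\<close>.\<close>

lemma prob_density_bound_pos:
  assumes f: "prob_density \<mu> f" and "AE x in \<mu>. \<bar>f x\<bar> \<le> L"
  shows "0 < L"
proof (rule ccontr)
  assume "\<not> 0 < L"
  then have "AE x in \<mu>. f x = 0" using assms(2) by (auto elim!: eventually_mono)
  then have "(\<integral>x. f x \<partial>\<mu>) = 0"
    using integral_cong_AE[of f \<mu> "\<lambda>_. 0"] f by (simp add: prob_density_def)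
  then show False using prob_density_integral[OF f] by simp
qed

text \<open>A negative bound would make the whole space a null set, which cannot carry a probability
  density.\<close>

lemma prob_density_AE_bound_nonneg:
  fixes g :: "'a \<Rightarrow> real"
  assumes f: "prob_density \<mu> f" and "AE x in \<mu>. \<bar>g x\<bar> \<le> K"
  shows "0 \<le> K"
proof (rule ccontr)
  assume "\<not> 0 \<le> K"
  then have "AE x in \<mu>. False" using assms(2) by (auto elim!: eventually_mono)
  then have "AE x in \<mu>. \<bar>f x\<bar> \<le> 0" by (rule eventually_mono) simp
  then show False using prob_density_bound_pos[OF f] by blast
qed

text \<open>Boundedness of the \<open>F j\<close> makes \<open>F j * f\<close> integrable, so the
  linear part of the risk is an inner product with the true means. This is the left side of
  \<open>penalized_form_min_oracle\<close>.\<close>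

lemma risk_mixture:
  assumes "prob_density \<mu> f" "\<And>j. F j \<in> L2_functions \<mu>" "\<And>j. AE x in \<mu>. \<bar>F j x\<bar> \<le> K"
  shows "risk \<mu> f (mixture F v)
    = mixture_form \<mu> F v v - 2 * ((\<chi> j. \<integral>x. F j x * f x \<partial>\<mu>) \<bullet> v)"
proof -
  have int: "integrable \<mu> (\<lambda>x. F j x * f x)" for j
    using assms by (intro integrable_bounded_mult[where K = K] prob_density_integrable)
      (auto simp: L2_functions_def)
  have "(\<integral>x. mixture F v x * f x \<partial>\<mu>) = (\<integral>x. (\<Sum>j\<in>UNIV. v $ j * (F j x * f x)) \<partial>\<mu>)"
    by (simp add: mixture_def sum_distrib_right mult.assoc)
  also have "\<dots> = (\<Sum>j\<in>UNIV. v $ j * (\<integral>x. F j x * f x \<partial>\<mu>))"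
    using int by simp
  finally show ?thesis
    by (simp add: risk_def norm_L2_mixture inner_vec_def mult.commute)
qed

text \<open>A vanishing integral of the squared difference forces the two mixtures to agree almost
  everywhere, and the risk sees only such classes.\<close>

lemma risk_mixture_eqI:
  assumes "f \<in> borel_measurable \<mu>" and F: "\<And>j. F j \<in> L2_functions \<mu>"
    and 0: "mixture_form \<mu> F (v - w) (v - w) = 0"
  shows "risk \<mu> f (mixture F v) = risk \<mu> f (mixture F w)"
proof -
  have [measurable]: "mixture F v \<in> borel_measurable \<mu>" "mixture F w \<in> borel_measurable \<mu>"
    and int: "integrable \<mu> (\<lambda>x. mixture F (v - w) x * mixture F (v - w) x)"
    using mixture_L2_functions[of F \<mu>, OF F] by (auto simp: L2_functions_def power2_eq_square)
  note assms(1)[measurable]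
  have "AE x in \<mu>. mixture F (v - w) x * mixture F (v - w) x = 0"
    using 0 int by (subst integral_nonneg_eq_0_iff_AE[symmetric]) (auto simp: mixture_form_def)
  then have AE: "AE x in \<mu>. mixture F v x = mixture F w x"
    by (simp add: mixture_diff)
  have "(\<integral>x. (mixture F v x)\<^sup>2 \<partial>\<mu>) = (\<integral>x. (mixture F w x)\<^sup>2 \<partial>\<mu>)"
    by (rule integral_cong_AE) (use AE in auto)
  moreover have "(\<integral>x. mixture F v x * f x \<partial>\<mu>) = (\<integral>x. mixture F w x * f x \<partial>\<mu>)"
    by (rule integral_cong_AE) (use AE in auto)
  ultimately show ?thesis by (simp add: risk_def norm_L2_power2)
qed

section \<open>Measurability of the risk of the selected mixture\<close>

lemma continuous_on_bilinear:
  fixes B :: "'b::euclidean_space \<Rightarrow> 'c::euclidean_space \<Rightarrow> real"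
  assumes "bilinear B" "continuous_on S g" "continuous_on S h"
  shows "continuous_on S (\<lambda>x. B (g x) (h x))"
  using assms bilinear_conv_bounded_bilinear bounded_bilinear.continuous_on by blast

text \<open>The minimizer itself need not depend measurably on the data, but its risk does, since all
  minimizers define the same element of \<open>L\<^sup>2\<close>.\<close>

lemma measurable_risk_argmin:
  fixes F :: "'m::finite \<Rightarrow> 'a \<Rightarrow> real" and \<theta>hat :: "'w \<Rightarrow> real ^ 'm"
  assumes f: "prob_density \<mu> f" and F: "\<And>j. F j \<in> L2_functions \<mu>"
    and bound: "\<And>j. AE x in \<mu>. \<bar>F j x\<bar> \<le> L0"
    and X: "\<And>i. i \<in> {1..n} \<Longrightarrow> X i \<in> P \<rightarrow>\<^sub>M \<mu>"
    and min: "\<And>\<omega>. \<omega> \<in> space P \<Longrightarrow>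
      is_arg_min (Q_objective \<mu> F n (\<lambda>i. X i \<omega>)) (\<lambda>\<theta>. \<theta> \<in> prob_simplex) (\<theta>hat \<omega>)"
  shows "(\<lambda>\<omega>. risk \<mu> f (mixture F (\<theta>hat \<omega>))) \<in> borel_measurable P"
proof (rule borel_measurableI_le)
  fix K
  define B where "B = mixture_form \<mu> F"
  define c :: "'w \<Rightarrow> real ^ 'm" where "c \<omega> = (\<chi> j. (\<Sum>i=1..n. F j (X i \<omega>)) / real n)" for \<omega>
  define C where "C = {c. \<exists>\<theta>. is_arg_min (penalized_form B c) (\<lambda>\<theta>. \<theta> \<in> prob_simplex) \<theta>
    \<and> risk \<mu> f (mixture F \<theta>) \<le> K}"
  note B = bilinear_mixture_form[of F \<mu>, OF F, folded B_def]
  have "closed C"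
    unfolding C_def penalized_form_def risk_mixture[OF f F bound] B_def[symmetric]
    by (intro closed_argmin_sublevel compact_prob_simplex)
      (auto simp: case_prod_beta intro!: continuous_intros continuous_on_bilinear[OF B])
  have Fj: "F j \<in> borel_measurable \<mu>" for j using F by (simp add: L2_functions_def)
  have FX: "(\<lambda>\<omega>. F j (X i \<omega>)) \<in> borel_measurable P" if "i \<in> {1..n}" for i j
    using X[OF that] Fj by (rule measurable_compose)
  have c: "c \<in> borel_measurable P"
    unfolding c_def
    by (subst borel_measurable_euclidean_space)
      (auto simp: Basis_vec_def inner_axis intro!: borel_measurable_divide borel_measurable_sum FX)
  \<comment> \<open>Membership in \<open>C\<close> asks only for some minimizer of risk at most
    \<open>K\<close>. All minimizers have the same risk, so this decides the question for
    \<open>\<theta>hat \<omega>\<close>.\<close>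
  have "{\<omega> \<in> space P. risk \<mu> f (mixture F (\<theta>hat \<omega>)) \<le> K} = c -` C \<inter> space P"
  proof -
    have "c \<omega> \<in> C \<longleftrightarrow> risk \<mu> f (mixture F (\<theta>hat \<omega>)) \<le> K" if "\<omega> \<in> space P" for \<omega>
    proof
      have \<theta>: "is_arg_min (penalized_form B (c \<omega>)) (\<lambda>\<theta>. \<theta> \<in> prob_simplex) (\<theta>hat \<omega>)"
        using min[OF that] by (simp add: Q_objective_eq_penalized_form B_def c_def)
      assume "c \<omega> \<in> C"
      then obtain \<eta> where \<eta>: "is_arg_min (penalized_form B (c \<omega>)) (\<lambda>\<theta>. \<theta> \<in> prob_simplex) \<eta>"
        and le: "risk \<mu> f (mixture F \<eta>) \<le> K"
        by (auto simp: C_def)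
      have "B (\<theta>hat \<omega> - \<eta>) (\<theta>hat \<omega> - \<eta>) = 0"
        using penalized_form_min_unique[OF B _ _ \<theta> \<eta>]
        by (simp add: B_def mixture_form_sym mixture_form_nonneg)
      with f F have "risk \<mu> f (mixture F (\<theta>hat \<omega>)) = risk \<mu> f (mixture F \<eta>)"
        by (intro risk_mixture_eqI) (auto simp: prob_density_def B_def)
      with le show "risk \<mu> f (mixture F (\<theta>hat \<omega>)) \<le> K" by simp
    qed (use min[OF that] in \<open>auto simp: C_def Q_objective_eq_penalized_form B_def c_def\<close>)
    then show ?thesis by auto
  qed
  also have "\<dots> \<in> sets P"
    using c \<open>closed C\<close> by (intro measurable_sets[OF c]) auto
  finally show "{\<omega> \<in> space P. risk \<mu> f (mixture F (\<theta>hat \<omega>)) \<le> K} \<in> sets P" .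
qed

section \<open>The oracle inequality\<close>

lemma (in prob_space) distributed_density_integral:
  fixes f h :: "'b \<Rightarrow> real"
  assumes X: "distributed M N X (\<lambda>y. ennreal (f y))" and f: "f \<in> borel_measurable N" "AE y in N. 0 \<le> f y"
    and h: "h \<in> borel_measurable N"
  shows "expectation (\<lambda>\<omega>. h (X \<omega>)) = (\<integral>y. h y * f y \<partial>N)"
proof -
  have "expectation (\<lambda>\<omega>. h (X \<omega>)) = integral\<^sup>L (distr M N X) h"
    using distributed_measurable[OF X] h by (simp add: integral_distr)
  also have "distr M N X = density N (\<lambda>y. ennreal (f y))"
    using X by (rule distributed_distr_eq_density)
  also have "integral\<^sup>L \<dots> h = (\<integral>y. h y * f y \<partial>N)"
    using f h by (simp add: integral_density mult.commute)
  finally show ?thesis .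
qed

lemma (in prob_space) distributed_AE:
  assumes X: "distributed M N X D" and "AE y in N. Q y"
  shows "AE \<omega> in M. Q (X \<omega>)"
proof -
  have "AE y in density N D. Q y"
    using assms(2) distributed_borel_measurable[OF X]
    by (subst AE_density) (auto elim!: eventually_mono)
  then have "AE y in distr M N X. Q y"
    unfolding distributed_distr_eq_density[OF X] .
  then show ?thesis by (rule AE_distrD[OF distributed_measurable[OF X]])
qed

text \<open>The penalty \<open>\<integral>g\<^sup>2 / 2\<close> absorbs the variance term of Bernstein's inequality because
  \<open>E g(X)\<^sup>2 \<le> L \<integral>g\<^sup>2\<close>; the exponential parameter \<open>1 / (2 L + 2 a / 3)\<close> makes the two cancel exactly.\<close>

lemma (in prob_space) penalized_deviation_bound:
  fixes f g :: "'b \<Rightarrow> real"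
  assumes n: "0 < n"
    and f: "prob_density \<mu> f" and fL: "AE y in \<mu>. \<bar>f y\<bar> \<le> L"
    and indep: "indep_vars (\<lambda>_. \<mu>) X {1..n}"
    and X: "\<And>i. i \<in> {1..n} \<Longrightarrow> distributed M \<mu> (X i) (\<lambda>y. ennreal (f y))"
    and g: "g \<in> L2_functions \<mu>" and ga: "AE y in \<mu>. \<bar>g y\<bar> \<le> a"
  shows "prob {\<omega> \<in> space M. (4 * L + 4 * a / 3) * (u / real n)
      < 2 * ((\<Sum>i=1..n. g (X i \<omega>)) / real n - (\<integral>y. g y * f y \<partial>\<mu>)) - 1 / 2 * (\<integral>y. (g y)\<^sup>2 \<partial>\<mu>)}
    \<le> exp (- u)"
proof -
  have L: "0 < L" using f fL by (rule prob_density_bound_pos)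
  have a: "0 \<le> a" using f ga by (rule prob_density_AE_bound_nonneg)
  have gm[measurable]: "g \<in> borel_measurable \<mu>" and g2: "integrable \<mu> (\<lambda>y. (g y)\<^sup>2)"
    using g by (auto simp: L2_functions_def)
  have fm[measurable]: "f \<in> borel_measurable \<mu>" and f0: "AE y in \<mu>. 0 \<le> f y"
    using f by (auto simp: prob_density_def)
  define m where "m = (\<integral>y. g y * f y \<partial>\<mu>)"
  define s where "s = (\<integral>y. (g y)\<^sup>2 \<partial>\<mu>)"
  define l where "l = 1 / (2 * L + 2 * a / 3)"
  \<comment> \<open>This is the inequality of the event multiplied by \<open>n / 2\<close>, with the
    penalty moved to the threshold side.\<close>
  define t where "t = (2 * L + 2 * a / 3) * u + real n * s / 4"
  define Z where "Z i \<omega> = g (X i \<omega>) - m" for i \<omega>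
  \<comment> \<open>The centred variables are bounded by \<open>2 * a\<close>; the last identity
    reduces Bernstein's denominator to a multiple of \<open>L\<close>, which then cancels against
    the variance bound \<open>L * s\<close>.\<close>
  have l: "0 < l" "l * (2 * a) < 3" "1 - l * (2 * a) / 3 = 2 * L * l"
    using L a by (auto simp: l_def field_simps)
  have gX: "random_variable borel (\<lambda>\<omega>. g (X i \<omega>))" if "i \<in> {1..n}" for i
    using distributed_measurable[OF X[OF that]] gm by (rule measurable_compose)
  have gXa: "AE \<omega> in M. \<bar>g (X i \<omega>)\<bar> \<le> a" if "i \<in> {1..n}" for i
    using X[OF that] ga by (rule distributed_AE)
  have int: "integrable M (\<lambda>\<omega>. g (X i \<omega>))" if "i \<in> {1..n}" for i
    using gXa[OF that] gX[OF that] by (intro integrable_const_bound[where B = a]) auto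
  have int2: "integrable M (\<lambda>\<omega>. (g (X i \<omega>))\<^sup>2)" if "i \<in> {1..n}" for i
  proof (rule integrable_const_bound[where B = "a\<^sup>2"])
    show "AE \<omega> in M. norm ((g (X i \<omega>))\<^sup>2) \<le> a\<^sup>2"
      using gXa[OF that] by eventually_elim (simp flip: abs_le_square_iff)
  qed (use gX[OF that] in simp)
  have m: "expectation (\<lambda>\<omega>. g (X i \<omega>)) = m" if "i \<in> {1..n}" for i
    unfolding m_def using X[OF that] fm f0 gm by (rule distributed_density_integral)
  \<comment> \<open>The mean is bounded through the first observation, which exists because
    \<open>n\<close> is positive.\<close>
  have ma: "\<bar>m\<bar> \<le> a"
  proof -
    have i: "1 \<in> {1..n}" using n by simp
    have "\<bar>m\<bar> \<le> expectation (\<lambda>\<omega>. \<bar>g (X 1 \<omega>)\<bar>)"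
      unfolding m[OF i, symmetric] by (rule integral_abs_bound)
    also have "\<dots> \<le> expectation (\<lambda>_. a)"
      using int[OF i] gXa[OF i] by (intro integral_mono_AE) auto
    finally show ?thesis by (simp add: prob_space)
  qed
  have second_moment: "expectation (\<lambda>\<omega>. (g (X i \<omega>))\<^sup>2) \<le> L * s" if "i \<in> {1..n}" for i
  proof -
    have "expectation (\<lambda>\<omega>. (g (X i \<omega>))\<^sup>2) = (\<integral>y. (g y)\<^sup>2 * f y \<partial>\<mu>)"
      using distributed_density_integral[OF X[OF that] fm f0, of "\<lambda>y. (g y)\<^sup>2"] by simp
    also have "\<dots> \<le> (\<integral>y. L * (g y)\<^sup>2 \<partial>\<mu>)"
    proof (rule integral_mono_AE')
      show "AE y in \<mu>. (g y)\<^sup>2 * f y \<le> L * (g y)\<^sup>2"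
        using fL by eventually_elim (simp add: mult.commute mult_right_mono)
      show "AE y in \<mu>. 0 \<le> L * (g y)\<^sup>2" using L by simp
    qed (use g2 in simp)
    finally show ?thesis using g2 by (simp add: s_def)
  qed
  have bern: "prob {\<omega> \<in> space M. t \<le> (\<Sum>i=1..n. Z i \<omega>)}
      \<le> exp (real (card {1..n}) * (l\<^sup>2 * (L * s) / (2 * (1 - l * (2 * a) / 3))) - l * t)"
  proof (rule bernstein_ineq_ge)
    show "indep_vars (\<lambda>_. borel) Z {1..n}"
      unfolding Z_def using indep by (rule indep_vars_compose2) simp
    fix i assume i: "i \<in> {1..n}"
    show "AE \<omega> in M. \<bar>Z i \<omega>\<bar> \<le> 2 * a"
      using gXa[OF i] by eventually_elim (use ma in \<open>auto simp: Z_def\<close>)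
    show "expectation (Z i) = 0"
      unfolding Z_def using int[OF i] m[OF i] by (simp add: prob_space)
    have "expectation (\<lambda>\<omega>. (Z i \<omega>)\<^sup>2) = expectation (\<lambda>\<omega>. (g (X i \<omega>))\<^sup>2 - 2 * m * g (X i \<omega>) + m\<^sup>2)"
      by (simp add: Z_def power2_diff algebra_simps)
    also have "\<dots> = expectation (\<lambda>\<omega>. (g (X i \<omega>))\<^sup>2) - m\<^sup>2"
      using int[OF i] int2[OF i] m[OF i] by (simp add: prob_space power2_eq_square)
    also have "\<dots> \<le> L * s" using second_moment[OF i] zero_le_power2[of m] by linarith
    finally show "expectation (\<lambda>\<omega>. (Z i \<omega>)\<^sup>2) \<le> L * s" .
  qed (use l in auto)
  \<comment> \<open>The variance contributes \<open>n * l * s / 4\<close> to the exponent and the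
    penalty inside \<open>t\<close> subtracts the same amount, leaving \<open>- u\<close>.\<close>
  have "l * t = u + l * (real n * s / 4)"
    using L a by (simp add: t_def l_def distrib_left add_pos_nonneg)
  moreover have "l\<^sup>2 * (L * s) / (2 * (2 * L * l)) = l * s / 4"
    using l L by (simp add: power2_eq_square)
  ultimately have exponent:
    "real (card {1..n}) * (l\<^sup>2 * (L * s) / (2 * (1 - l * (2 * a) / 3))) - l * t = - u"
    unfolding l(3) by simp
  have "prob {\<omega> \<in> space M. (4 * L + 4 * a / 3) * (u / real n)
      < 2 * ((\<Sum>i=1..n. g (X i \<omega>)) / real n - m) - 1 / 2 * s}
    \<le> prob {\<omega> \<in> space M. t \<le> (\<Sum>i=1..n. Z i \<omega>)}"
  proof (rule finite_measure_mono)
    show "{\<omega> \<in> space M. (4 * L + 4 * a / 3) * (u / real n)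
        < 2 * ((\<Sum>i=1..n. g (X i \<omega>)) / real n - m) - 1 / 2 * s}
      \<subseteq> {\<omega> \<in> space M. t \<le> (\<Sum>i=1..n. Z i \<omega>)}"
    proof (intro subsetI CollectI; elim CollectE conjE; intro conjI)
      fix \<omega>
      assume "(4 * L + 4 * a / 3) * (u / real n) < 2 * ((\<Sum>i=1..n. g (X i \<omega>)) / real n - m) - 1 / 2 * s"
      then have "real n * ((4 * L + 4 * a / 3) * (u / real n))
          < real n * (2 * ((\<Sum>i=1..n. g (X i \<omega>)) / real n - m) - 1 / 2 * s)"
        using n by (intro mult_strict_left_mono) auto
      then show "t \<le> (\<Sum>i=1..n. Z i \<omega>)"
        using n by (simp add: Z_def t_def sum_subtractf algebra_simps)
    qed
    show "{\<omega> \<in> space M. t \<le> (\<Sum>i=1..n. Z i \<omega>)} \<in> events"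
    proof -
      have "random_variable borel (\<lambda>\<omega>. \<Sum>i=1..n. Z i \<omega>)"
        unfolding Z_def using gX by (intro borel_measurable_sum borel_measurable_diff) auto
      then show ?thesis by measurable
    qed
  qed
  also note bern
  also note exponent
  finally show ?thesis by (simp add: m_def s_def)
qed

theorem corollary3p1:
  fixes P :: "'w measure" and \<mu> :: "'a measure"
    and f :: "'a \<Rightarrow> real" and F :: "'m::finite \<Rightarrow> 'a \<Rightarrow> real"
    and X :: "nat \<Rightarrow> 'w \<Rightarrow> 'a" and \<theta>hat :: "'w \<Rightarrow> real ^ 'm"
    and n :: nat and L L0 x :: real
  assumes "prob_space P"
    and "0 < n"
    and "prob_density \<mu> f"
    and "prob_space.indep_vars P (\<lambda>_. \<mu>) X {1..n}"
    and "\<And>i. i \<in> {1..n} \<Longrightarrow> distributed P \<mu> (X i) (\<lambda>y. ennreal (f y))"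
    and "\<And>j. F j \<in> L2_functions \<mu>"
    and "\<And>j. norm_Linf \<mu> (F j) \<le> ereal L0"
    and "norm_Linf \<mu> f \<le> ereal L"
    and "\<And>\<omega>. \<omega> \<in> space P \<Longrightarrow>
           is_arg_min (Q_objective \<mu> F n (\<lambda>i. X i \<omega>)) (\<lambda>\<theta>. \<theta> \<in> prob_simplex) (\<theta>hat \<omega>)"
    and "0 < x"
  shows "measure P {\<omega> \<in> space P.
             risk \<mu> f (mixture F (\<theta>hat \<omega>))
               \<le> (MIN j. risk \<mu> f (F j))
                 + (4 * L + 8 * L0 / 3) * ((ln (real CARD('m)) + x) / real n)}
           > 1 - exp (- x)"
proof -
  note n = assms(2) and f = assms(3) and indep = assms(4) and X = assms(5) and F = assms(6)
    and min = assms(9)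
  interpret P: prob_space P by fact
  have bound: "AE y in \<mu>. \<bar>F j y\<bar> \<le> L0" for j by (rule norm_Linf_leD[OF assms(7)])
  have fL: "AE y in \<mu>. \<bar>f y\<bar> \<le> L" by (rule norm_Linf_leD[OF assms(8)])
  have L: "0 < L" using f fL by (rule prob_density_bound_pos)
  \<comment> \<open>Any index serves here, since the index type is nonempty.\<close>
  have L0: "0 \<le> L0" using f bound[of undefined] by (rule prob_density_AE_bound_nonneg)
  define B where "B = mixture_form \<mu> F"
  have B: "bilinear B" "\<And>v w. B v w = B w v"
    using bilinear_mixture_form[of F \<mu>, OF F] by (simp_all add: B_def mixture_form_sym)
  define p where "p = (\<chi> j. \<integral>y. F j y * f y \<partial>\<mu>)"
  define c :: "'w \<Rightarrow> real ^ 'm" where "c \<omega> = (\<chi> j. (\<Sum>i=1..n. F j (X i \<omega>)) / real n)" for \<omega>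
  note risk_eq = risk_mixture[of \<mu> f F, OF f F bound, folded B_def p_def]
  \<comment> \<open>The logarithm pays for the union bound: \<open>exp (- u)\<close> is
    \<open>exp (- x)\<close> divided by the number of functions.\<close>
  define u where "u = ln (real CARD('m)) + x"
  define K where "K = (4 * L + 8 * L0 / 3) * (u / real n)"
  have K: "0 \<le> K" using L L0 assms(10) by (simp add: K_def u_def)
  have "(MIN j. risk \<mu> f (F j)) \<in> range (\<lambda>j. risk \<mu> f (F j))" by (intro Min_in) auto
  then obtain k where k: "(MIN j. risk \<mu> f (F j)) = risk \<mu> f (F k)" by (rule rangeE)
  \<comment> \<open>These are the terms averaged by \<theta> in the oracle bound against the best
    index \<open>k\<close>.\<close>
  define D where "D j \<omega> = 2 * ((c \<omega> - p) \<bullet> (axis j 1 - axis k 1))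
    - 1 / 2 * B (axis j 1 - axis k 1) (axis j 1 - axis k 1)" for j \<omega>
  define bad where "bad j = {\<omega> \<in> space P. K < D j \<omega>}" for j
  define good where "good = {\<omega> \<in> space P. risk \<mu> f (mixture F (\<theta>hat \<omega>)) \<le> risk \<mu> f (F k) + K}"

  have XP: "X i \<in> P \<rightarrow>\<^sub>M \<mu>" if "i \<in> {1..n}" for i by (rule distributed_measurable[OF X[OF that]])
  have good_meas: "good \<in> sets P"
    using measurable_risk_argmin[of \<mu> f F, OF f F bound XP min] unfolding good_def by measurable

  have bad_prob: "P.prob (bad j) \<le> exp (- x) / real CARD('m)" and bad_meas: "bad j \<in> sets P" for j
  proof -
    \<comment> \<open>Each difference is bounded by \<open>2 * L0\<close>, which turns the constant
      \<open>4 * a / 3\<close> of the deviation bound into \<open>8 * L0 / 3\<close>.\<close>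
    define g where "g y = F j y - F k y" for y
    have g: "g \<in> L2_functions \<mu>" unfolding g_def using F F by (rule L2_functions_diff)
    have ga: "AE y in \<mu>. \<bar>g y\<bar> \<le> 2 * L0"
      using bound[of j] bound[of k] by eventually_elim (auto simp: g_def)
    have int: "integrable \<mu> (\<lambda>y. F i y * f y)" for i
      using F[of i] by (intro integrable_bounded_mult[OF prob_density_integrable[OF f] _ bound])
        (simp add: L2_functions_def)
    have D_eq: "D j \<omega> = 2 * ((\<Sum>i=1..n. g (X i \<omega>)) / real n - (\<integral>y. g y * f y \<partial>\<mu>))
      - 1 / 2 * (\<integral>y. (g y)\<^sup>2 \<partial>\<mu>)" for \<omega>
    proof -
      have "mixture F (axis j 1 - axis k 1) = g"
        by (simp add: fun_eq_iff mixture_diff mixture_axis g_def)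
      then have "B (axis j 1 - axis k 1) (axis j 1 - axis k 1) = (\<integral>y. (g y)\<^sup>2 \<partial>\<mu>)"
        by (simp add: B_def mixture_form_def power2_eq_square)
      moreover have "p \<bullet> (axis j 1 - axis k 1) = (\<integral>y. g y * f y \<partial>\<mu>)"
        using int by (simp add: p_def g_def inner_diff_right inner_axis left_diff_distrib)
      moreover have "c \<omega> \<bullet> (axis j 1 - axis k 1) = (\<Sum>i=1..n. g (X i \<omega>)) / real n"
        by (simp add: c_def g_def inner_diff_right inner_axis sum_subtractf diff_divide_distrib)
      ultimately show ?thesis by (simp add: D_def inner_diff_left)
    qed
    have "P.prob (bad j) \<le> exp (- u)"
      using P.penalized_deviation_bound[OF n f fL indep X g ga, of u]
      by (simp add: bad_def D_eq K_def)
    then show "P.prob (bad j) \<le> exp (- x) / real CARD('m)"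
      by (simp add: u_def exp_add exp_minus exp_diff field_simps)
    have "g \<in> borel_measurable \<mu>" using g by (simp add: L2_functions_def)
    then have "(\<lambda>\<omega>. g (X i \<omega>)) \<in> borel_measurable P" if "i \<in> {1..n}" for i
      by (rule measurable_compose[OF XP[OF that]])
    then have "(\<lambda>\<omega>. \<Sum>i=1..n. g (X i \<omega>)) \<in> borel_measurable P"
      by (rule borel_measurable_sum)
    then have "D j \<in> borel_measurable P" unfolding D_eq[abs_def] by simp
    then show "bad j \<in> sets P" unfolding bad_def by measurable
  qed

  \<comment> \<open>Outside the bad events every \<open>D j\<close> is at most \<open>K\<close>,
    including \<open>D k = 0\<close>; hence so is their convex combination with weights
    \<open>\<theta>hat \<omega>\<close>.\<close>
  have "space P - good \<subseteq> (\<Union>j\<in>UNIV - {k}. bad j)"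
  proof
    fix \<omega> assume "\<omega> \<in> space P - good"
    then have \<omega>: "\<omega> \<in> space P" "\<omega> \<notin> good" by auto
    show "\<omega> \<in> (\<Union>j\<in>UNIV - {k}. bad j)"
    proof (rule ccontr)
      assume "\<omega> \<notin> (\<Union>j\<in>UNIV - {k}. bad j)"
      then have nb: "D j \<omega> \<le> K" if "j \<noteq> k" for j
        using that \<omega>(1) by (auto simp: bad_def not_less)
      have "D k \<omega> = 0" using bilinear_lzero[OF B(1)] by (simp add: D_def)
      with nb K have DK: "D j \<omega> \<le> K" for j by (cases "j = k") auto
      have \<theta>: "is_arg_min (penalized_form B (c \<omega>)) (\<lambda>\<theta>. \<theta> \<in> prob_simplex) (\<theta>hat \<omega>)"
        using min[OF \<omega>(1)] by (simp add: Q_objective_eq_penalized_form B_def c_def)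
      then have simplex: "\<theta>hat \<omega> \<in> prob_simplex" by (simp add: is_arg_min_linorder)
      have "risk \<mu> f (mixture F (\<theta>hat \<omega>)) \<le> risk \<mu> f (mixture F (axis k 1))
          + (\<Sum>j\<in>UNIV. \<theta>hat \<omega> $ j * D j \<omega>)"
        unfolding risk_eq D_def by (rule penalized_form_min_oracle[OF B \<theta>])
      also have "(\<Sum>j\<in>UNIV. \<theta>hat \<omega> $ j * D j \<omega>) \<le> (\<Sum>j\<in>UNIV. \<theta>hat \<omega> $ j * K)"
        using simplex DK by (intro sum_mono mult_left_mono) (auto simp: prob_simplex_def)
      also have "\<dots> = K" using simplex by (simp add: prob_simplex_def flip: sum_distrib_right)
      finally have "\<omega> \<in> good" using \<omega> by (simp add: good_def mixture_axis)
      with \<omega> show False by simp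
    qed
  qed
  \<comment> \<open>Since \<open>j = k\<close> never causes failure, the union bound has a term to spare: this makes it strict.\<close>
  then have "P.prob (space P - good) \<le> P.prob (\<Union>j\<in>UNIV - {k}. bad j)"
    using bad_meas by (intro P.finite_measure_mono) auto
  also have "\<dots> \<le> (\<Sum>j\<in>UNIV - {k}. P.prob (bad j))"
    using bad_meas by (intro P.finite_measure_subadditive_finite) auto
  also have "\<dots> \<le> (\<Sum>j\<in>UNIV - {k}. exp (- x) / real CARD('m))"
    by (intro sum_mono bad_prob)
  also have "\<dots> < (\<Sum>j\<in>(UNIV :: 'm set). exp (- x) / real CARD('m))"
    by (rule sum_strict_mono2[where b = k]) auto
  also have "\<dots> = exp (- x)" by simp
  finally have "P.prob good > 1 - exp (- x)"
    using P.prob_compl[OF good_meas] by simp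
  then show ?thesis by (simp add: good_def k K_def u_def)
qed

end
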